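(* Let $X_1,X_2,\dots,X_n$ be Boolean independent identically distributed copies of a (self-adjoint) random variable $X$ with variance $1$, and let $\overline X=\frac1n\sum_{i=1}^nX_i$. Then $Q_n=\sum_{i=1}^n(X_i-\overline X)^2$ is distributed according to the Boolean Poisson law with rate $n$ and jump size $1-\frac1n$ if and only if $X$ is an even Poisson random variable.
   Context: A noncommutative probability space is a pair $(\mathcal A,\varphi)$ with $\mathcal A$ a unital $*$-algebra and $\varphi$ a normal state; random variables are self-adjoint elements. Subalgebras $(\mathcal A_i)$ are Boolean independent if $\varphi(X_1\cdots X_m)=\varphi(X_1)\cdots\varphi(X_m)$ whenever $X_j\in\mathcal A_{i(j)}$ with consecutive indices $i(j)\neq i(j+1)$; random variables are Boolean independent if the (not necessarily unital) subalgebras they generate are. $\mathcal I(n)$ is the set of interval partitions of $\{1,\dots,n\}$ (blocks consist of consecutive integers). Boolean cumulants $K_n$ are the multilinear functionals defined by $\varphi(X_1\cdots X_n)=\sum_{\pi\in\mathcal I(n)}\prod_{B\in\pi}K_{|B|}(X_i:i\in B)$; $K_n(X)=K_n(X,\dots,X)$. The variance is $K_2(X)$. Identically distributed means all cumulants coincide. The Boolean Poisson law with rate $\lambda\ge0$ and jump size $\alpha\ge0$ is $\nu(\lambda,\alpha)=\frac1{\lambda+1}(\delta_0+\lambda\delta_{\alpha(\lambda+1)})$; equivalently its Boolean cumulants are $K_r=\lambda\alpha^r$ for all $r\geq 1$. $X$ is even Poisson if $K_{2m}(X)=1$ for all $m\ge1$.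
   Formalization: The formal statement assumes n ≥ 2; for n = 1 the claim is false, since Q_1 = 0 always has the Boolean Poisson law with rate 1 and jump size 0, whatever X is (e.g. X = ±1 with K_4 = 0). *)

theory Defs
  imports "HOL-Probability.Probability"
begin

text \<open>The carrier of the unital \<open>*\<close>-algebra is the whole type \<open>'a\<close>; the class \<open>ring_1\<close>
  supplies the (noncommutative) ring structure and \<open>smul\<close> the complex scalar multiplication.\<close>

locale star_algebra = vector_space smul
  for smul :: "complex \<Rightarrow> 'a::ring_1 \<Rightarrow> 'a" +
  fixes star :: "'a \<Rightarrow> 'a"
  assumes scale_mult_left: "smul c x * y = smul c (x * y)"
    and scale_mult_right: "x * smul c y = smul c (x * y)"
    and star_add: "star (x + y) = star x + star y"
    and star_scale: "star (smul c x) = smul (cnj c) (star x)"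
    and star_mult: "star (x * y) = star y * star x"
    and star_star: "star (star x) = x"

definition self_adjoint :: "('a \<Rightarrow> 'a) \<Rightarrow> 'a set" where
  "self_adjoint star = {a. star a = a}"

text \<open>The order of a \<open>*\<close>-algebra, given by the cone of finite sums \<open>\<Sum> b\<^sup>* b\<close>; in a C*- or
  von Neumann algebra this is the usual operator order.\<close>

definition star_le :: "('a::ring_1 \<Rightarrow> 'a) \<Rightarrow> 'a \<Rightarrow> 'a \<Rightarrow> bool" where
  "star_le star a b \<longleftrightarrow> (\<exists>cs. b - a = (\<Sum>c\<leftarrow>cs. star c * c))"

definition star_directed :: "('a::ring_1 \<Rightarrow> 'a) \<Rightarrow> 'a set \<Rightarrow> bool" where
  "star_directed star D \<longleftrightarrow>
     D \<noteq> {} \<and> (\<forall>a\<in>D. \<forall>b\<in>D. \<exists>c\<in>D. star_le star a c \<and> star_le star b c)"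

definition star_lub :: "('a::ring_1 \<Rightarrow> 'a) \<Rightarrow> 'a set \<Rightarrow> 'a \<Rightarrow> bool" where
  "star_lub star D s \<longleftrightarrow> s \<in> self_adjoint star \<and> (\<forall>d\<in>D. star_le star d s) \<and>
     (\<forall>t\<in>self_adjoint star. (\<forall>d\<in>D. star_le star d t) \<longrightarrow> star_le star s t)"

text \<open>Normality is preservation of suprema of directed sets of self-adjoint elements. A state is
  real on self-adjoint elements, so taking real parts loses nothing.\<close>

definition normal_functional :: "('a::ring_1 \<Rightarrow> 'a) \<Rightarrow> ('a \<Rightarrow> complex) \<Rightarrow> bool" where
  "normal_functional star \<phi> \<longleftrightarrow>
     (\<forall>D s. D \<subseteq> self_adjoint star \<and> star_directed star D \<and> star_lub star D s \<longrightarrow>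
        Re (\<phi> s) = (SUP d\<in>D. Re (\<phi> d)))"

locale nc_prob_space = star_algebra smul star
  for smul :: "complex \<Rightarrow> 'a::ring_1 \<Rightarrow> 'a" and star :: "'a \<Rightarrow> 'a" +
  fixes \<phi> :: "'a \<Rightarrow> complex"
  assumes state_linear: "Vector_Spaces.linear smul (*) \<phi>"
    and state_positive: "\<phi> (star a * a) \<in> \<real>\<^sub>\<ge>\<^sub>0"
    and state_unit: "\<phi> 1 = 1"
    and state_normal: "normal_functional star \<phi>"

text \<open>Subalgebras are not required to contain the unit: for unital subalgebras Boolean
  independence degenerates.\<close>

definition subalgebra :: "(complex \<Rightarrow> 'a::ring_1 \<Rightarrow> 'a) \<Rightarrow> 'a set \<Rightarrow> bool" where
  "subalgebra smul S \<longleftrightarrow> module.subspace smul S \<and> (\<forall>x\<in>S. \<forall>y\<in>S. x * y \<in> S)"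

definition boolean_indep_algebras :: "('a::ring_1 \<Rightarrow> complex) \<Rightarrow> 'i set \<Rightarrow> ('i \<Rightarrow> 'a set) \<Rightarrow> bool" where
  "boolean_indep_algebras \<phi> I B \<longleftrightarrow>
     (\<forall>w :: ('i \<times> 'a) list.
        (\<forall>(i, x)\<in>set w. i \<in> I \<and> x \<in> B i) \<and> distinct_adj (map fst w) \<longrightarrow>
        \<phi> (\<Prod>(i, x)\<leftarrow>w. x) = (\<Prod>(i, x)\<leftarrow>w. \<phi> x))"

definition boolean_indep ::
    "(complex \<Rightarrow> 'a::ring_1 \<Rightarrow> 'a) \<Rightarrow> ('a \<Rightarrow> complex) \<Rightarrow> 'i set \<Rightarrow> ('i \<Rightarrow> 'a) \<Rightarrow> bool" where
  "boolean_indep smul \<phi> I X \<longleftrightarrow>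
     boolean_indep_algebras \<phi> I (\<lambda>i. subalgebra smul hull {X i})"

text \<open>Positions are counted from 0, so that \<open>nths xs B\<close> is the tuple of entries with position in \<open>B\<close>.\<close>

definition interval_partitions :: "nat \<Rightarrow> nat set set set" where
  "interval_partitions n = {\<pi>. partition_on {..<n} \<pi> \<and> (\<forall>B\<in>\<pi>. \<exists>a b. B = {a..<b})}"

lemma finite_interval_partitions: "finite (interval_partitions n)"
proof (rule finite_subset)
  show "interval_partitions n \<subseteq> Pow (Pow {..<n})"
    by (auto simp: interval_partitions_def partition_on_def)
qed auto

lemma interval_partition_block:
  assumes "\<pi> \<in> interval_partitions n - {{{..<n}}}" "B \<in> \<pi>"
  shows "B \<subset> {..<n}"
proof -
  have p: "\<Union>\<pi> = {..<n}" "disjoint \<pi>" "{} \<notin> \<pi>" "\<pi> \<noteq> {{..<n}}"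
    using assms(1) by (auto simp: interval_partitions_def partition_on_def)
  have "B \<noteq> {..<n}"
  proof
    assume B: "B = {..<n}"
    have "C = B" if "C \<in> \<pi>" for C
    proof (rule ccontr)
      assume "C \<noteq> B"
      then have "C \<inter> B = {}"
        using p(2) that assms(2) by (auto simp: disjoint_def)
      moreover have "C \<subseteq> B" using that p(1) B by auto
      ultimately show False using that p(3) by (metis inf.absorb1)
    qed
    then have "\<pi> = {{..<n}}" using assms(2) B by blast
    then show False using p(4) by simp
  qed
  moreover have "B \<subseteq> {..<n}" using p(1) assms(2) by auto
  ultimately show ?thesis by auto
qed

lemma length_nths_less:
  assumes "B \<subset> {..<length xs}"
  shows "length (nths xs B) < length xs"
proof -
  have "length (nths xs B) = card B"
    using assms by (auto simp: length_nths intro!: arg_cong[of _ _ card])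
  also have "\<dots> < card {..<length xs}"
    using assms by (intro psubset_card_mono) auto
  finally show ?thesis by simp
qed

text \<open>The moment-cumulant formula solved for the cumulant belonging to the one-block partition;
  the formula itself is lemma \<open>moment_boolean_cumulant\<close> below. The value on \<open>[]\<close> is immaterial.\<close>

function boolean_cumulant :: "('a::monoid_mult \<Rightarrow> complex) \<Rightarrow> 'a list \<Rightarrow> complex" where
  "boolean_cumulant \<phi> xs = \<phi> (prod_list xs) -
     (\<Sum>\<pi>\<in>interval_partitions (length xs) - {{{..<length xs}}}.
        \<Prod>B\<in>\<pi>. boolean_cumulant \<phi> (nths xs B))"
  by auto
termination
proof (relation "Wellfounded.measure (\<lambda>(\<phi>, xs). length xs)")
  fix \<phi> :: "'a \<Rightarrow> complex" and xs :: "'a list" and \<pi> B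
  assume "\<pi> \<in> interval_partitions (length xs) - {{{..<length xs}}}" "B \<in> \<pi>"
  then show "((\<phi>, nths xs B), (\<phi>, xs)) \<in> Wellfounded.measure (\<lambda>(\<phi>, xs). length xs)"
    unfolding in_measure split_conv by (rule length_nths_less[OF interval_partition_block])
qed simp

declare boolean_cumulant.simps [simp del]

lemma moment_boolean_cumulant:
  assumes "xs \<noteq> []"
  shows "\<phi> (prod_list xs) =
    (\<Sum>\<pi>\<in>interval_partitions (length xs). \<Prod>B\<in>\<pi>. boolean_cumulant \<phi> (nths xs B))"
proof -
  let ?I = "interval_partitions (length xs)" and ?top = "{{..<length xs}}"
  let ?K = "\<lambda>\<pi>. \<Prod>B\<in>\<pi>. boolean_cumulant \<phi> (nths xs B)"
  have "{..<length xs} = {0..<length xs}" by (rule lessThan_atLeast0)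
  then have "?top \<in> ?I"
    using assms unfolding interval_partitions_def partition_on_def disjoint_def by blast
  then have "(\<Sum>\<pi>\<in>?I. ?K \<pi>) = ?K ?top + (\<Sum>\<pi>\<in>?I - {?top}. ?K \<pi>)"
    by (rule sum.remove[OF finite_interval_partitions])
  moreover have "nths xs {..<length xs} = xs" by simp
  then have "?K ?top = boolean_cumulant \<phi> xs" by (simp only: prod.insert finite.emptyI empty_iff
      not_False_eq_True prod.empty mult_1_right)
  ultimately show ?thesis
    using boolean_cumulant.simps[of \<phi> xs] by (simp only: diff_add_cancel)
qed

definition cumulant_of :: "('a::monoid_mult \<Rightarrow> complex) \<Rightarrow> nat \<Rightarrow> 'a \<Rightarrow> complex" where
  "cumulant_of \<phi> r X = boolean_cumulant \<phi> (replicate r X)"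

definition identically_distributed :: "('a::monoid_mult \<Rightarrow> complex) \<Rightarrow> 'a \<Rightarrow> 'a \<Rightarrow> bool" where
  "identically_distributed \<phi> X Y \<longleftrightarrow> (\<forall>r\<ge>1. cumulant_of \<phi> r X = cumulant_of \<phi> r Y)"

definition even_poisson :: "('a::monoid_mult \<Rightarrow> complex) \<Rightarrow> 'a \<Rightarrow> bool" where
  "even_poisson \<phi> X \<longleftrightarrow> (\<forall>m\<ge>1. cumulant_of \<phi> (2 * m) X = 1)"

text \<open>In an algebraic probability space the distribution of an element is its moment sequence. Laws
  of bounded support, such as the one below, are determined by their moments.\<close>

definition has_law :: "('a::monoid_mult \<Rightarrow> complex) \<Rightarrow> 'a \<Rightarrow> real measure \<Rightarrow> bool" where
  "has_law \<phi> a M \<longleftrightarrow>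
     (\<forall>k. integrable M (\<lambda>x. x ^ k) \<and> \<phi> (a ^ k) = complex_of_real (\<integral>x. x ^ k \<partial>M))"

text \<open>The mixture \<open>(\<delta>\<^sub>0 + r \<delta>\<^bsub>a(r+1)\<^esub>) / (r + 1)\<close>, for \<open>r \<ge> 0\<close>; see the lemma that follows.\<close>

definition boolean_poisson :: "real \<Rightarrow> real \<Rightarrow> real pmf" where
  "boolean_poisson r a =
     map_pmf (\<lambda>b. if b then a * (r + 1) else 0) (bernoulli_pmf (r / (r + 1)))"

lemma measure_boolean_poisson:
  assumes "r \<ge> 0"
  shows "measure (boolean_poisson r a) A =
    1 / (r + 1) * (indicator A 0 + r * indicator A (a * (r + 1)))"
proof -
  have p: "0 \<le> r / (r + 1)" "r / (r + 1) \<le> 1" "1 - r / (r + 1) = 1 / (r + 1)"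
    using assms by (auto simp: field_simps)
  have "measure (boolean_poisson r a) A =
      measure_pmf.expectation (boolean_poisson r a) (indicator A)"
    by simp
  also have "\<dots> = r / (r + 1) * indicator A (a * (r + 1)) + 1 / (r + 1) * indicator A 0"
    unfolding boolean_poisson_def integral_map_pmf
    using p by simp
  finally show ?thesis by (simp add: algebra_simps)
qed

definition sample_mean :: "(complex \<Rightarrow> 'a::ring_1 \<Rightarrow> 'a) \<Rightarrow> nat \<Rightarrow> (nat \<Rightarrow> 'a) \<Rightarrow> 'a" where
  "sample_mean smul n X = smul (1 / of_nat n) (\<Sum>i=1..n. X i)"

end

theory Submission
  imports Defs
begin

text \<open>
  Write \<open>Q = \<Sum>\<^sub>i\<^sub>j a\<^sub>i\<^sub>j X\<^sub>i X\<^sub>j\<close> with \<open>a\<^sub>i\<^sub>j = \<delta>\<^sub>i\<^sub>j - 1/n\<close>. The proof rests on the cumulant identity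
  \<open>K\<^sub>r(Q) = n (1 - 1/n)\<^sup>r K\<^sub>2\<^sub>r(X)\<close>. Expanded over interval partitions, \<open>K\<^sub>r(Q)\<close> collects the
  partitions of \<open>2r\<close> letters whose cuts fall only inside one of the \<open>r\<close> pairs \<open>X\<^sub>i X\<^sub>j\<close>. By
  independence all letters of a block carry the same index, so a partition with a cut contributes
  a factor \<open>\<Sum>\<^sub>j a\<^sub>i\<^sub>j = 0\<close>, and the uncut one contributes \<open>\<Sum>\<^sub>i a\<^sub>i\<^sub>i\<^sup>r K\<^sub>2\<^sub>r(X)\<close>. The Boolean Poisson law with
  rate \<open>n\<close> and jump \<open>1 - 1/n\<close> has cumulants \<open>n (1 - 1/n)\<^sup>r\<close>, and since \<open>1 - 1/n \<noteq> 0\<close> the two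
  cumulant sequences agree exactly when every \<open>K\<^sub>2\<^sub>r(X)\<close> is \<open>1\<close>.

  The cumulants of \<open>Q\<close> never appear as such. Boolean cumulants are the coefficients \<open>c\<close> in the
  recursion \<open>m\<^sub>k = \<Sum>\<^sub>j c\<^sub>j m\<^bsub>k-j\<^esub>\<close> for the moments, and by \<open>recursion_determines_coefficients\<close> it is
  enough to exhibit such a recursion for the moments of \<open>Q\<close> (\<open>Q_moment_recursion\<close>) and for those
  of the law (\<open>boolean_poisson_moment_recursion\<close>). The former is found by reading a word from the
  left while keeping its first block open. The functional \<open>open_block\<close> records this state, and it
  is linear in the unread part, so that powers of \<open>Q\<close> can be processed one factor at a time
  without being expanded into words.
\<close>

section \<open>Moments and cumulants\<close>

lemma interval_partitions_0: "interval_partitions 0 = {{}}"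
  by (auto simp: interval_partitions_def partition_on_def)

text \<open>Splitting off the last block rather than the first leaves an interval partition of an initial
  segment, so that nothing has to be shifted.\<close>

lemma interval_partitions_last_block:
  assumes "k > 0"
  shows "interval_partitions k = (\<Union>m<k. insert {m..<k} ` interval_partitions m)"
proof (intro equalityI subsetI)
  fix \<pi> assume "\<pi> \<in> interval_partitions k"
  then have U: "\<Union>\<pi> = {..<k}" and D: "disjoint \<pi>" and E: "{} \<notin> \<pi>"
    and J: "\<And>B. B \<in> \<pi> \<Longrightarrow> \<exists>a b. B = {a..<b}"
    by (auto simp: interval_partitions_def partition_on_def)
  have "k - 1 \<in> \<Union>\<pi>" unfolding U using assms by simp
  then obtain B where B: "B \<in> \<pi>" "k - 1 \<in> B" by (rule UnionE)
  then obtain m b where mb: "B = {m..<b}" using J by blast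
  have "b - 1 \<in> B" using B(2) mb by auto
  then have "b - 1 \<in> {..<k}" unfolding U[symmetric] using B(1) by (rule UnionI[rotated])
  then have "b = k" "m < k" using B mb assms by auto
  have "\<Union>(\<pi> - {B}) = {..<k} - B"
    unfolding U[symmetric] using D B(1) unfolding disjoint_def by blast
  also have "\<dots> = {..<m}" using mb \<open>b = k\<close> \<open>m < k\<close> by auto
  finally have "\<pi> - {B} \<in> interval_partitions m"
    using D E J unfolding interval_partitions_def partition_on_def disjoint_def by simp
  moreover have "\<pi> = insert {m..<k} (\<pi> - {B})" using B mb \<open>b = k\<close> by auto
  ultimately show "\<pi> \<in> (\<Union>m<k. insert {m..<k} ` interval_partitions m)"
    using \<open>m < k\<close> by blast
next
  fix \<pi> assume "\<pi> \<in> (\<Union>m<k. insert {m..<k} ` interval_partitions m)"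
  then obtain m \<rho> where m: "m < k" and \<rho>: "\<rho> \<in> interval_partitions m" "\<pi> = insert {m..<k} \<rho>"
    by blast
  have P: "partition_on {..<m} \<rho>" using \<rho> by (simp add: interval_partitions_def)
  then have "disjnt {m..<k} (\<Union>\<rho>)"
    unfolding partition_onD1[OF P, symmetric] disjnt_def by auto
  moreover have "{..<k} - {m..<k} = {..<m}" "{m..<k} \<noteq> {}"
    "{m..<k} \<subseteq> {..<k}" using m by auto
  ultimately have "partition_on {..<k} \<pi>"
    unfolding \<rho>(2) using P by (simp add: partition_on_insert)
  then show "\<pi> \<in> interval_partitions k"
    using \<rho> by (auto simp: interval_partitions_def)
qed

lemma sum_interval_partitions_last_block:
  fixes f :: "nat \<Rightarrow> 'b::comm_semiring_1"
  assumes "k > 0"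
  shows "(\<Sum>\<pi>\<in>interval_partitions k. \<Prod>B\<in>\<pi>. f (card B)) =
    (\<Sum>m<k. f (k - m) * (\<Sum>\<pi>\<in>interval_partitions m. \<Prod>B\<in>\<pi>. f (card B)))"
proof -
  let ?P = "\<lambda>\<pi>. \<Prod>B\<in>\<pi>. f (card B)"
  have block: "{m..<k} \<notin> \<pi>" "\<Union>\<pi> = {..<m}" "finite \<pi>"
    if "\<pi> \<in> interval_partitions m" "m < k" for m \<pi>
  proof -
    show U: "\<Union>\<pi> = {..<m}"
      using that by (auto simp: interval_partitions_def partition_on_def)
    show "{m..<k} \<notin> \<pi>"
    proof
      assume "{m..<k} \<in> \<pi>"
      moreover have "m \<in> {m..<k}" using that by simp
      ultimately have "m \<in> \<Union>\<pi>" by blast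
      then show False using U by simp
    qed
    show "finite \<pi>" using U by (metis finite_UnionD finite_lessThan)
  qed
  have inj: "inj_on (insert {m..<k}) (interval_partitions m)" if "m < k" for m
    using block that by (intro inj_onI) (metis insert_ident)
  have "(\<Sum>\<pi>\<in>interval_partitions k. ?P \<pi>) =
      (\<Sum>m<k. \<Sum>\<pi>\<in>insert {m..<k} ` interval_partitions m. ?P \<pi>)"
    unfolding interval_partitions_last_block[OF assms]
  proof (rule sum.UNION_disjoint)
    show "\<forall>m\<in>{..<k}. \<forall>m'\<in>{..<k}. m \<noteq> m' \<longrightarrow>
        insert {m..<k} ` interval_partitions m \<inter> insert {m'..<k} ` interval_partitions m' = {}"
    proof (intro ballI impI, rule ccontr)
      fix m m' assume m: "m \<in> {..<k}" "m' \<in> {..<k}" "m \<noteq> m'"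
        and "insert {m..<k} ` interval_partitions m
          \<inter> insert {m'..<k} ` interval_partitions m' \<noteq> {}"
      then obtain \<rho> \<rho>' where \<rho>: "\<rho> \<in> interval_partitions m" "\<rho>' \<in> interval_partitions m'"
        "insert {m..<k} \<rho> = insert {m'..<k} \<rho>'" by blast
      have ne: "{m..<k} \<noteq> {m'..<k}" using m by (auto simp: atLeastLessThan_eq_iff)
      have "{m..<k} \<in> \<rho>'" "{m'..<k} \<in> \<rho>" using \<rho>(3) ne by blast+
      then have "{m..<k} \<subseteq> {..<m'}" "{m'..<k} \<subseteq> {..<m}"
        using block(2) \<rho> m by blast+
      then have "k - 1 < m'" "k - 1 < m" using m by (auto simp: subset_eq)
      then show False using m by auto
    qed
  qed (auto simp: finite_interval_partitions)
  also have "\<dots> = (\<Sum>m<k. \<Sum>\<pi>\<in>interval_partitions m. ?P (insert {m..<k} \<pi>))"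
    by (rule sum.cong[OF refl]) (simp add: sum.reindex[OF inj] del: prod.insert)
  also have "\<dots> = (\<Sum>m<k. f (k - m) * (\<Sum>\<pi>\<in>interval_partitions m. ?P \<pi>))"
    unfolding sum_distrib_left using block(1,3) by (intro sum.cong refl) (simp add: prod.insert)
  finally show ?thesis .
qed

lemma nths_replicate:
  assumes "B \<subseteq> {..<k}"
  shows "nths (replicate k x) B = replicate (card B) x"
proof (rule replicate_eqI)
  have "{i. i < k \<and> i \<in> B} = B" using assms by auto
  then show "length (nths (replicate k x) B) = card B" by (simp add: length_nths)
  show "y = x" if "y \<in> set (nths (replicate k x) B)" for y
    using in_set_nthsD[OF that] by simp
qed

lemma moment_eq_sum_interval_partitions:
  assumes "\<phi> 1 = 1"
  shows "\<phi> (x ^ k) =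
    (\<Sum>\<pi>\<in>interval_partitions k. \<Prod>B\<in>\<pi>. cumulant_of \<phi> (card B) x)"
proof (cases "k = 0")
  case True
  then show ?thesis using assms by (simp add: interval_partitions_0)
next
  case False
  have "\<phi> (x ^ k) = \<phi> (prod_list (replicate k x))"
    by simp
  also have "\<dots> = (\<Sum>\<pi>\<in>interval_partitions k.
      \<Prod>B\<in>\<pi>. boolean_cumulant \<phi> (nths (replicate k x) B))"
    using False moment_boolean_cumulant[of "replicate k x" \<phi>] by simp
  also have "\<dots> = (\<Sum>\<pi>\<in>interval_partitions k. \<Prod>B\<in>\<pi>. cumulant_of \<phi> (card B) x)"
    unfolding cumulant_of_def
    by (intro sum.cong prod.cong refl arg_cong[of _ _ "boolean_cumulant \<phi>"] nths_replicate)
       (auto simp: interval_partitions_def partition_on_def)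
  finally show ?thesis .
qed

lemma moment_recursion:
  assumes "\<phi> 1 = 1" "k > 0"
  shows "\<phi> (x ^ k) = (\<Sum>m<k. cumulant_of \<phi> (k - m) x * \<phi> (x ^ m))"
  unfolding moment_eq_sum_interval_partitions[of \<phi>, OF assms(1)]
  by (rule sum_interval_partitions_last_block[OF assms(2)])

text \<open>Comparing cumulants is the same as comparing moments: the recursion is triangular in both
  directions, because \<open>c k\<close> enters the equation for \<open>u k\<close> with the coefficient \<open>u 0 = 1\<close>.\<close>

lemma recursion_determines_coefficients:
  fixes u v c d :: "nat \<Rightarrow> 'b::comm_ring_1"
  assumes "u 0 = 1" "v 0 = 1"
    and u: "\<And>k. k > 0 \<Longrightarrow> u k = (\<Sum>m<k. c (k - m) * u m)"
    and v: "\<And>k. k > 0 \<Longrightarrow> v k = (\<Sum>m<k. d (k - m) * v m)"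
  shows "(\<forall>k. u k = v k) \<longleftrightarrow> (\<forall>k>0. c k = d k)"
proof
  assume cd: "\<forall>k>0. c k = d k"
  have "u k = v k" for k
  proof (induction k rule: less_induct)
    case (less k)
    show ?case
    proof (cases "k = 0")
      case False
      then have "u k = (\<Sum>m<k. c (k - m) * u m)" by (simp add: u)
      also have "\<dots> = (\<Sum>m<k. d (k - m) * v m)"
        using cd less by (intro sum.cong) auto
      finally show ?thesis using False by (simp add: v)
    qed (use assms in simp)
  qed
  then show "\<forall>k. u k = v k" by blast
next
  assume uv: "\<forall>k. u k = v k"
  have "k > 0 \<longrightarrow> c k = d k" for k
  proof (induction k rule: less_induct)
    case (less k)
    show ?case
    proof
      assume k: "k > 0"
      \<comment> \<open>The term \<open>m = 0\<close> is the only one that involves the coefficient of index \<open>k\<close>.\<close>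
      have split: "(\<Sum>m<k. g m) = g 0 + (\<Sum>m\<in>{1..<k}. g m)" for g :: "nat \<Rightarrow> 'b"
        using k by (simp add: lessThan_atLeast0 sum.atLeast_Suc_lessThan)
      have "(\<Sum>m\<in>{1..<k}. c (k - m) * u m) = (\<Sum>m\<in>{1..<k}. d (k - m) * v m)"
        using less uv by (intro sum.cong) auto
      moreover have "(\<Sum>m<k. c (k - m) * u m) = (\<Sum>m<k. d (k - m) * v m)"
        using u[OF k] v[OF k] uv by simp
      ultimately show "c k = d k" by (simp add: split assms)
    qed
  qed
  then show "\<forall>k>0. c k = d k" by blast
qed

section \<open>The Boolean Poisson law\<close>

lemma boolean_poisson_moment:
  assumes "r \<ge> 0"
  shows "measure_pmf.expectation (boolean_poisson r a) (\<lambda>x. x ^ k) =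
    (if k = 0 then 1 else r * a ^ k * (r + 1) ^ (k - 1))"
proof -
  have p: "0 \<le> r / (r + 1)" "r / (r + 1) \<le> 1" "1 - r / (r + 1) = 1 / (r + 1)"
    using assms by (auto simp: field_simps)
  have "measure_pmf.expectation (boolean_poisson r a) (\<lambda>x. x ^ k) =
      r / (r + 1) * (a * (r + 1)) ^ k + 1 / (r + 1) * 0 ^ k"
    unfolding boolean_poisson_def integral_map_pmf using p by simp
  also have "\<dots> = (if k = 0 then 1 else r * a ^ k * (r + 1) ^ (k - 1))"
  proof (cases k)
    case 0
    then show ?thesis using assms by (simp add: add_divide_distrib[symmetric])
  next
    case (Suc j)
    have "r / s * (a * s) ^ Suc j = r * a ^ Suc j * s ^ j" if "s \<noteq> 0" for s :: real
      using that by (simp add: power_mult_distrib)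
    from this[of "r + 1"] show ?thesis using assms Suc by simp
  qed
  finally show ?thesis .
qed

lemma integrable_boolean_poisson:
  "integrable (measure_pmf (boolean_poisson r a)) (\<lambda>x. x ^ k)"
  by (rule integrable_measure_pmf_finite) (simp add: boolean_poisson_def)

text \<open>The law with rate \<open>r\<close> and jump \<open>a\<close> has the Boolean cumulants \<open>r * a ^ j\<close>. They are geometric,
  so the recursion for \<open>k + 1\<close> is \<open>a\<close> times the one for \<open>k\<close> plus a single new term.\<close>

lemma boolean_poisson_moment_recursion:
  fixes r a :: real
  assumes "r \<ge> 0" "k > 0"
  defines "u \<equiv> \<lambda>k. measure_pmf.expectation (boolean_poisson r a) (\<lambda>x. x ^ k)"
  shows "u k = (\<Sum>m<k. (r * a ^ (k - m)) * u m)"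
  using assms(2)
proof (induction k rule: nat_induct_non_zero)
  case 1
  then show ?case using assms(1) by (simp add: u_def boolean_poisson_moment)
next
  case (Suc k)
  have "(\<Sum>m<Suc k. r * a ^ (Suc k - m) * u m) =
      (\<Sum>m<k. a * (r * a ^ (k - m) * u m)) + r * a * u k"
    by (auto simp: Suc_diff_le intro!: sum.cong)
  also have "\<dots> = a * u k + r * a * u k"
    using Suc.IH by (simp add: sum_distrib_left)
  also have "\<dots> = u (Suc k)"
    using Suc.hyps assms(1) by (cases k) (simp_all add: u_def boolean_poisson_moment algebra_simps)
  finally show ?case by simp
qed

section \<open>Words in Boolean independent variables\<close>

lemma subalgebra_hull_power:
  assumes "p > 0"
  shows "x ^ p \<in> subalgebra smul hull {x}"
  using assms
proof (induction p rule: nat_induct_non_zero)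
  case (Suc p)
  then show ?case by (auto simp: hull_def subalgebra_def)
qed (simp add: hull_inc)

lemma subalgebra_hull_mult:
  "y \<in> subalgebra smul hull {x} \<Longrightarrow> x * y \<in> subalgebra smul hull {x}"
  by (auto simp: hull_def subalgebra_def)

text \<open>Independence speaks about words in which neighbouring letters come from different
  subalgebras; an arbitrary word reaches this form by merging runs of equal indices. The first
  index is kept, which allows a further letter to be put in front.\<close>

lemma word_as_alternating_product:
  fixes Xs :: "'i \<Rightarrow> 'a::ring_1"
  assumes "set (l # ls) \<subseteq> I"
  shows "\<exists>x w. (\<forall>(i, y)\<in>set ((l, x) # w). i \<in> I \<and> y \<in> subalgebra smul hull {Xs i}) \<and>
    distinct_adj (map fst ((l, x) # w)) \<and>
    prod_list (map Xs (l # ls)) = (\<Prod>(i, y)\<leftarrow>(l, x) # w. y)"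
  using assms
proof (induction ls arbitrary: l)
  case Nil
  then show ?case by (intro exI[of _ "Xs l"] exI[of _ "[]"]) (auto simp: hull_inc)
next
  case (Cons l' ls)
  have "set (l' # ls) \<subseteq> I" using Cons.prems by simp
  from Cons.IH[OF this] obtain x w where w:
    "\<forall>(i, y)\<in>set ((l', x) # w). i \<in> I \<and> y \<in> subalgebra smul hull {Xs i}"
    "distinct_adj (map fst ((l', x) # w))"
    "prod_list (map Xs (l' # ls)) = (\<Prod>(i, y)\<leftarrow>(l', x) # w. y)"
    by (elim exE conjE)
  have prod: "prod_list (map Xs (l # l' # ls)) = Xs l * (\<Prod>(i, y)\<leftarrow>(l', x) # w. y)"
    using w(3) by simp
  show ?case
  proof (cases "l = l'")
    case True
    then show ?thesis using w prod
      by (intro exI[of _ "Xs l * x"] exI[of _ w])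
         (auto simp: subalgebra_hull_mult mult.assoc distinct_adj_Cons)
  next
    case False
    then show ?thesis using w prod Cons.prems
      by (intro exI[of _ "Xs l"] exI[of _ "(l', x) # w"]) (auto simp: hull_inc)
  qed
qed

context nc_prob_space
begin

lemma state_add: "\<phi> (x + y) = \<phi> x + \<phi> y"
  and state_diff: "\<phi> (x - y) = \<phi> x - \<phi> y"
  and state_smul: "\<phi> (smul c x) = c * \<phi> x"
  and state_zero: "\<phi> 0 = 0"
  and state_sum: "\<phi> (\<Sum>i\<in>A. g i) = (\<Sum>i\<in>A. \<phi> (g i))"
proof -
  interpret linear: Vector_Spaces.linear smul "(*)" \<phi> by (rule state_linear)
  show "\<phi> (x + y) = \<phi> x + \<phi> y" by (rule linear.add)
  show "\<phi> (x - y) = \<phi> x - \<phi> y" by (rule linear.diff)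
  show "\<phi> (smul c x) = c * \<phi> x" by (rule linear.scale)
  show "\<phi> 0 = 0" by (rule linear.zero)
  show "\<phi> (\<Sum>i\<in>A. g i) = (\<Sum>i\<in>A. \<phi> (g i))" by (rule linear.sum)
qed

abbreviation word_span :: "'i set \<Rightarrow> ('i \<Rightarrow> 'a) \<Rightarrow> 'a set" where
  "word_span I Xs \<equiv> module.span smul ((\<lambda>ls. prod_list (map Xs ls)) ` lists I)"

lemma word_span_one: "1 \<in> word_span I Xs"
  by (rule span_base) (auto intro!: image_eqI[of _ _ "[]"])

lemma word_span_letter_mult:
  assumes "W \<in> word_span I Xs" "i \<in> I"
  shows "Xs i * W \<in> word_span I Xs"
  using assms(1)
proof (induction W rule: span_induct_alt)
  case base
  then show ?case by (simp add: span_zero)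
next
  case (step c W V)
  then obtain ls where "ls \<in> lists I" "W = prod_list (map Xs ls)" by blast
  then have "Xs i * W \<in> word_span I Xs"
    using assms(2) by (intro span_base image_eqI[of _ _ "i # ls"]) auto
  then show ?case
    using step by (simp add: distrib_left scale_mult_right span_add span_scale)
qed

text \<open>A power of one variable splits off from anything that begins with another variable. Words
  suffice, since both sides are linear in \<open>W\<close>.\<close>

lemma boolean_indep_factor:
  assumes indep: "boolean_indep smul \<phi> I Xs" and "i \<in> I" "l \<in> I" "i \<noteq> l" "p > 0"
    and "W \<in> word_span I Xs"
  shows "\<phi> (Xs i ^ p * (Xs l * W)) = \<phi> (Xs i ^ p) * \<phi> (Xs l * W)"
  using assms(6)
proof (induction W rule: span_induct_alt)
  case base
  then show ?case by (simp add: state_zero)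
next
  case (step c W V)
  then obtain ls where ls: "ls \<in> lists I" "W = prod_list (map Xs ls)" by blast
  have "set (l # ls) \<subseteq> I" using ls assms(3) by auto
  from word_as_alternating_product[OF this, of smul Xs] obtain x w where w:
    "\<forall>(i, y)\<in>set ((l, x) # w). i \<in> I \<and> y \<in> subalgebra smul hull {Xs i}"
    "distinct_adj (map fst ((l, x) # w))"
    "prod_list (map Xs (l # ls)) = (\<Prod>(i, y)\<leftarrow>(l, x) # w. y)"
    by (elim exE conjE)
  have word: "Xs l * W = (\<Prod>(i, y)\<leftarrow>(l, x) # w. y)"
    using w(3) ls(2) by simp
  have mult: "\<phi> (\<Prod>(i, x)\<leftarrow>v. x) = (\<Prod>(i, x)\<leftarrow>v. \<phi> x)"
    if "\<forall>(i, x)\<in>set v. i \<in> I \<and> x \<in> subalgebra smul hull {Xs i}" "distinct_adj (map fst v)" for v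
    using indep that unfolding boolean_indep_def boolean_indep_algebras_def by blast
  have "\<phi> (Xs i ^ p * (Xs l * W)) = \<phi> (\<Prod>(i, y)\<leftarrow>(i, Xs i ^ p) # (l, x) # w. y)"
    using word by simp
  also have "\<dots> = \<phi> (Xs i ^ p) * (\<Prod>(i, y)\<leftarrow>(l, x) # w. \<phi> y)"
    using w assms subalgebra_hull_power[OF \<open>p > 0\<close>] by (subst mult) auto
  also have "(\<Prod>(i, y)\<leftarrow>(l, x) # w. \<phi> y) = \<phi> (Xs l * W)"
    unfolding word by (rule mult[symmetric]) (rule w)+
  finally show ?case
    using step by (simp add: distrib_left scale_mult_right state_add state_smul)
qed

section \<open>Peeling off the first block\<close>

text \<open>If \<open>W\<close> is a word in Boolean independent variables, \<open>x\<close> among them, this is the part of the moment-cumulant sum of \<open>x ^ p * W\<close> given by the interval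
  partitions whose first block contains the initial \<open>p\<close> letters: the partitions whose first block has
  length \<open>j < p\<close> are subtracted. This form, unlike the sum over partitions, makes sense for every
  \<open>W\<close> in the algebra and is visibly linear in it.\<close>

definition open_block :: "nat \<Rightarrow> 'a \<Rightarrow> 'a \<Rightarrow> complex" where
  "open_block p x W = \<phi> (x ^ p * W) - (\<Sum>j\<in>{1..<p}. cumulant_of \<phi> j x * \<phi> (x ^ (p - j) * W))"

lemma open_block_add: "open_block p x (V + W) = open_block p x V + open_block p x W"
  and open_block_diff: "open_block p x (V - W) = open_block p x V - open_block p x W"
  and open_block_smul: "open_block p x (smul c W) = c * open_block p x W"
  by (simp_all add: open_block_def distrib_left right_diff_distrib scale_mult_right state_add state_diff
      state_smul sum.distrib sum_subtractf sum_distrib_left mult.left_commute)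

lemma open_block_sum: "open_block p x (\<Sum>i\<in>A. g i) = (\<Sum>i\<in>A. open_block p x (g i))"
proof (induction A rule: infinite_finite_induct)
  case (insert i A)
  then show ?case by (simp add: open_block_add)
qed (simp_all add: open_block_def state_zero)

lemma open_block_one: "open_block 1 x W = \<phi> (x * W)"
  by (simp add: open_block_def)

lemma cumulant_eq_moments:
  assumes "p > 0"
  shows "cumulant_of \<phi> p x = \<phi> (x ^ p) - (\<Sum>j\<in>{1..<p}. cumulant_of \<phi> j x * \<phi> (x ^ (p - j)))"
proof -
  have "\<phi> (x ^ p) = (\<Sum>m<p. cumulant_of \<phi> (p - m) x * \<phi> (x ^ m))"
    by (rule moment_recursion[of \<phi>, OF state_unit assms])
  also have "\<dots> = cumulant_of \<phi> p x + (\<Sum>m\<in>{1..<p}. cumulant_of \<phi> (p - m) x * \<phi> (x ^ m))"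
    using assms by (simp add: lessThan_atLeast0 sum.atLeast_Suc_lessThan state_unit)
  also have "(\<Sum>m\<in>{1..<p}. cumulant_of \<phi> (p - m) x * \<phi> (x ^ m)) =
      (\<Sum>j\<in>{1..<p}. cumulant_of \<phi> j x * \<phi> (x ^ (p - j)))"
    by (rule sum.reindex_bij_witness[of _ "\<lambda>j. p - j" "\<lambda>m. p - m"]) auto
  finally show ?thesis by simp
qed

lemma open_block_unit: "p > 0 \<Longrightarrow> open_block p x 1 = cumulant_of \<phi> p x"
  using cumulant_eq_moments[of p x] by (simp add: open_block_def)

text \<open>If the next letter is again \<open>x\<close>, the first block either closes before it or absorbs it.\<close>

lemma open_block_same:
  assumes "p > 0"
  shows "open_block p x (x * W) = cumulant_of \<phi> p x * \<phi> (x * W) + open_block (p + 1) x W"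
proof -
  have "(\<Sum>j\<in>{1..<p}. cumulant_of \<phi> j x * \<phi> (x ^ (p + 1 - j) * W)) =
      (\<Sum>j\<in>{1..<p}. cumulant_of \<phi> j x * \<phi> (x ^ (p - j) * (x * W)))"
  proof (rule sum.cong[OF refl])
    fix j assume "j \<in> {1..<p}"
    then have "x ^ (p + 1 - j) = x ^ (p - j) * x"
      by (simp add: Suc_diff_le power_Suc2 del: power_Suc)
    then show "cumulant_of \<phi> j x * \<phi> (x ^ (p + 1 - j) * W) =
        cumulant_of \<phi> j x * \<phi> (x ^ (p - j) * (x * W))"
      by (simp add: mult.assoc)
  qed
  moreover have "{1..<p + 1} = insert p {1..<p}" using assms by auto
  moreover have "x ^ (p + 1) * W = x ^ p * (x * W)"
    by (simp add: power_Suc2 mult.assoc del: power_Suc)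
  ultimately show ?thesis by (simp add: open_block_def)
qed

text \<open>If what follows factors off, the first block has to close. Each moment \<open>\<phi> (x ^ q * V)\<close> then
  carries the factor \<open>\<phi> V\<close>, and the remaining combination of moments of \<open>x\<close> is a cumulant.\<close>

lemma open_block_other:
  assumes "p > 0" "\<And>q. q > 0 \<Longrightarrow> \<phi> (x ^ q * V) = \<phi> (x ^ q) * \<phi> V"
  shows "open_block p x V = cumulant_of \<phi> p x * \<phi> V"
proof -
  have "open_block p x V = \<phi> (x ^ p) * \<phi> V -
      (\<Sum>j\<in>{1..<p}. cumulant_of \<phi> j x * (\<phi> (x ^ (p - j)) * \<phi> V))"
    unfolding open_block_def using assms by (intro arg_cong2[of _ _ _ _ "(-)"] sum.cong) auto
  also have "\<dots> = cumulant_of \<phi> p x * \<phi> V"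
    unfolding cumulant_eq_moments[OF assms(1)]
    by (simp add: left_diff_distrib sum_distrib_right mult.assoc)
  finally show ?thesis .
qed

lemma open_block_letter:
  assumes "boolean_indep smul \<phi> I Xs" "i \<in> I" "l \<in> I" "p > 0" "W \<in> word_span I Xs"
  shows "open_block p (Xs i) (Xs l * W) =
    cumulant_of \<phi> p (Xs i) * \<phi> (Xs l * W) + (if l = i then open_block (p + 1) (Xs i) W else 0)"
proof (cases "l = i")
  case True
  then show ?thesis using assms(4) open_block_same by simp
next
  case False
  then show ?thesis using open_block_other[OF assms(4)] boolean_indep_factor[OF assms(1-3)] assms(5) by simp
qed

section \<open>The sample variance\<close>

text \<open>The form \<open>\<Sum>X\<^sub>i\<^sup>2 - S\<^sup>2 / n\<close> with \<open>S = \<Sum>X\<^sub>i\<close> survives without commutativity, because both cross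
  terms are equal to \<open>S\<^sup>2 / n\<close>. The trailing factor \<open>W\<close> brings it into the letter-by-letter shape that
  \<open>open_block\<close> can read.\<close>

lemma sum_squared_deviations:
  assumes "n > 0"
  shows "(\<Sum>i=1..n. (Xs i - sample_mean smul n Xs) ^ 2) * W =
    (\<Sum>l=1..n. Xs l * (Xs l * W)) -
    smul (1 / of_nat n) (\<Sum>l=1..n. \<Sum>m=1..n. Xs l * (Xs m * W))"
proof -
  define S where "S = (\<Sum>i=1..n. Xs i)"
  define M where "M = sample_mean smul n Xs"
  have M: "M = smul (1 / of_nat n) S" by (simp add: M_def S_def sample_mean_def)
  have nM: "of_nat n * M = S"
  proof -
    have sm: "of_nat k * x = smul (of_nat k) x" for k and x :: 'a
      by (induction k) (simp_all add: distrib_right scale_left_distrib)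
    show ?thesis using assms by (simp add: M sm)
  qed
  have "(\<Sum>i=1..n. (Xs i - M) ^ 2) = (\<Sum>i=1..n. Xs i * Xs i - Xs i * M - M * Xs i + M * M)"
    by (simp add: power2_eq_square algebra_simps)
  also have "\<dots> = (\<Sum>i=1..n. Xs i * Xs i) - S * M - M * S + of_nat n * (M * M)"
    by (simp add: sum.distrib sum_subtractf S_def sum_distrib_left sum_distrib_right)
  also have "of_nat n * (M * M) = S * M" using nM by (simp add: mult.assoc[symmetric])
  finally have "(\<Sum>i=1..n. (Xs i - M) ^ 2) = (\<Sum>i=1..n. Xs i * Xs i) - smul (1 / of_nat n) (S * S)"
    by (simp add: M scale_mult_left)
  moreover have "S * S * W = (\<Sum>l=1..n. \<Sum>m=1..n. Xs l * (Xs m * W))"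
    by (subst sum.swap) (simp add: S_def sum_distrib_left sum_distrib_right mult.assoc)
  ultimately show ?thesis
    by (simp add: M_def left_diff_distrib scale_mult_left sum_distrib_right mult.assoc)
qed

lemma sum_squared_deviations_word_span:
  assumes "n > 0" "W \<in> word_span {1..n} Xs"
  shows "(\<Sum>i=1..n. (Xs i - sample_mean smul n Xs) ^ 2) * W \<in> word_span {1..n} Xs"
  unfolding sum_squared_deviations[OF assms(1)]
  by (intro span_diff span_scale span_sum word_span_letter_mult assms(2))

end

text \<open>The common cumulants \<open>K\<close> are constrained only at positive indices, as the cumulant of the empty
  tuple carries no information.\<close>

locale boolean_sample = nc_prob_space smul star \<phi>
  for smul :: "complex \<Rightarrow> 'a::ring_1 \<Rightarrow> 'a" and star \<phi> +
  fixes n :: nat and Xs :: "nat \<Rightarrow> 'a" and K :: "nat \<Rightarrow> complex"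
  assumes n_pos: "n > 0"
    and indep: "boolean_indep smul \<phi> {1..n} Xs"
    and cumulants: "\<And>i r. i \<in> {1..n} \<Longrightarrow> r > 0 \<Longrightarrow> cumulant_of \<phi> r (Xs i) = K r"
begin

definition Q :: 'a where
  "Q = (\<Sum>i=1..n. (Xs i - sample_mean smul n Xs) ^ 2)"

definition jump :: complex where
  "jump = 1 - 1 / of_nat n"

lemma Q_power_word_span: "Q ^ k \<in> word_span {1..n} Xs"
  by (induction k) (simp_all add: word_span_one Q_def sum_squared_deviations_word_span n_pos
      del: One_nat_def)

lemma open_block_letter_sample:
  assumes "i \<in> {1..n}" "l \<in> {1..n}" "p > 0" "W \<in> word_span {1..n} Xs"
  shows "open_block p (Xs i) (Xs l * W) =
    K p * \<phi> (Xs l * W) + (if l = i then open_block (p + 1) (Xs i) W else 0)"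
  using open_block_letter[OF indep assms] cumulants assms by simp

lemma state_Q_mult:
  "\<phi> (Q * W) = (\<Sum>l=1..n. \<phi> (Xs l * (Xs l * W))) -
    1 / of_nat n * (\<Sum>l=1..n. \<Sum>m=1..n. \<phi> (Xs l * (Xs m * W)))"
  by (simp add: Q_def sum_squared_deviations n_pos state_diff state_smul state_sum
      del: One_nat_def)

text \<open>One factor of \<open>Q\<close> either closes the first block in front of it or is absorbed with weight
  \<open>a\<^sub>i\<^sub>i = jump\<close>. The third possibility, a cut between its two letters, gives
  \<open>K (p + 1) * (\<Sum>\<^sub>m a\<^sub>i\<^sub>m * \<phi> (Xs m * W))\<close>. It vanishes because \<open>\<Sum>\<^sub>m a\<^sub>i\<^sub>m = 0\<close>, provided that
  \<open>\<phi> (Xs m * W)\<close> does not depend on \<open>m\<close>.\<close>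

lemma open_block_Q_mult:
  assumes i: "i \<in> {1..n}" and p: "p > 0" and W: "W \<in> word_span {1..n} Xs"
    and c: "\<And>l. l \<in> {1..n} \<Longrightarrow> \<phi> (Xs l * W) = c"
  shows "open_block p (Xs i) (Q * W) = K p * \<phi> (Q * W) + jump * open_block (p + 2) (Xs i) W"
proof -
  let ?a = "1 / of_nat n :: complex"
  have letter: "open_block p (Xs i) (Xs l * (Xs m * W)) = K p * \<phi> (Xs l * (Xs m * W)) +
      (if l = i then K (p + 1) * c + (if m = i then open_block (p + 2) (Xs i) W else 0) else 0)"
    if "l \<in> {1..n}" "m \<in> {1..n}" for l m
    using that i p W c
    by (simp add: open_block_letter_sample word_span_letter_mult flip: Suc_eq_plus1
        del: One_nat_def)
  have "open_block p (Xs i) (Q * W) =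
      (\<Sum>l=1..n. open_block p (Xs i) (Xs l * (Xs l * W))) -
      ?a * (\<Sum>l=1..n. \<Sum>m=1..n. open_block p (Xs i) (Xs l * (Xs m * W)))"
    by (simp add: Q_def sum_squared_deviations n_pos open_block_diff open_block_smul open_block_sum
        del: One_nat_def)
  also have "(\<Sum>l=1..n. open_block p (Xs i) (Xs l * (Xs l * W))) =
      K p * (\<Sum>l=1..n. \<phi> (Xs l * (Xs l * W))) + (K (p + 1) * c + open_block (p + 2) (Xs i) W)"
  proof -
    have "(\<Sum>l=1..n. open_block p (Xs i) (Xs l * (Xs l * W))) =
        (\<Sum>l=1..n. K p * \<phi> (Xs l * (Xs l * W)) +
          (if l = i then K (p + 1) * c + open_block (p + 2) (Xs i) W else 0))"
      by (intro sum.cong refl) (simp add: letter)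
    then show ?thesis using i by (simp add: sum.distrib sum_distrib_left)
  qed
  also have "(\<Sum>l=1..n. \<Sum>m=1..n. open_block p (Xs i) (Xs l * (Xs m * W))) =
      K p * (\<Sum>l=1..n. \<Sum>m=1..n. \<phi> (Xs l * (Xs m * W))) +
      (of_nat n * (K (p + 1) * c) + open_block (p + 2) (Xs i) W)"
  proof -
    have "(\<Sum>m=1..n. open_block p (Xs i) (Xs l * (Xs m * W))) =
        K p * (\<Sum>m=1..n. \<phi> (Xs l * (Xs m * W))) +
        (if l = i then of_nat n * (K (p + 1) * c) + open_block (p + 2) (Xs i) W else 0)"
      if "l \<in> {1..n}" for l
    proof -
      have "(\<Sum>m=1..n. open_block p (Xs i) (Xs l * (Xs m * W))) =
          (\<Sum>m=1..n. K p * \<phi> (Xs l * (Xs m * W)) +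
          (if l = i then K (p + 1) * c + (if m = i then open_block (p + 2) (Xs i) W else 0) else 0))"
        using that by (intro sum.cong refl letter)
      then show ?thesis using i by (simp add: sum.distrib sum_distrib_left)
    qed
    then show ?thesis using i by (simp add: sum.distrib sum_distrib_left)
  qed
  also have "?a * (K p * B + (of_nat n * d + t)) = K p * (?a * B) + d + ?a * t" for B d t
    using n_pos by (simp add: distrib_left)
  finally show ?thesis
    by (simp only: state_Q_mult jump_def) (simp add: algebra_simps)
qed

text \<open>The right-hand side is the same for all \<open>i\<close>. For \<open>p = 1\<close> this is the symmetry that the induction
  step requires of \<open>W = Q ^ k\<close>.\<close>

lemma open_block_Q_power:
  assumes "i \<in> {1..n}" "p > 0"
  shows "open_block p (Xs i) (Q ^ k) = (\<Sum>t\<le>k. jump ^ t * K (p + 2 * t) * \<phi> (Q ^ (k - t)))"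
  using assms
proof (induction k arbitrary: p i)
  case 0
  then show ?case using open_block_unit cumulants by (simp add: state_unit)
next
  case (Suc k)
  have c: "\<phi> (Xs l * Q ^ k) = (\<Sum>t\<le>k. jump ^ t * K (1 + 2 * t) * \<phi> (Q ^ (k - t)))"
    if "l \<in> {1..n}" for l
    using Suc.IH[OF that, of 1] by (simp only: open_block_one zero_less_one)
  have "open_block p (Xs i) (Q ^ Suc k) =
      K p * \<phi> (Q ^ Suc k) + jump * open_block (p + 2) (Xs i) (Q ^ k)"
    using open_block_Q_mult[OF Suc.prems Q_power_word_span c] by simp
  also have "open_block (p + 2) (Xs i) (Q ^ k) =
      (\<Sum>t\<le>k. jump ^ t * K (p + 2 + 2 * t) * \<phi> (Q ^ (k - t)))"
    using Suc by simp
  also have "K p * \<phi> (Q ^ Suc k) + jump * \<dots> =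
      (\<Sum>t\<le>Suc k. jump ^ t * K (p + 2 * t) * \<phi> (Q ^ (Suc k - t)))"
    by (subst sum.atMost_Suc_shift) (simp add: sum_distrib_left mult.assoc)
  finally show ?case .
qed

lemma Q_moment_recursion:
  assumes "k > 0"
  shows "\<phi> (Q ^ k) = (\<Sum>m<k. (of_nat n * jump ^ (k - m) * K (2 * (k - m))) * \<phi> (Q ^ m))"
proof -
  obtain k' where k: "k = Suc k'" using assms by (cases k) auto
  \<comment> \<open>The first factor of \<open>Q\<close> opens a block and is not offered to an existing one, so its two
    letters are treated separately: the block starting with the first letter either closes inside
    the pair, and these terms cancel, or contains both letters, which leaves \<open>T 2\<close>.\<close>
  define T where "T = (\<lambda>p. \<Sum>t\<le>k'. jump ^ t * K (p + 2 * t) * \<phi> (Q ^ (k' - t)))"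
  have T: "open_block p (Xs i) (Q ^ k') = T p" if "i \<in> {1..n}" "p > 0" for i p
    unfolding T_def using that by (rule open_block_Q_power)
  have pair: "\<phi> (Xs l * (Xs m * Q ^ k')) = K 1 * T 1 + (if m = l then T 2 else 0)"
    if "l \<in> {1..n}" "m \<in> {1..n}" for l m
    using open_block_letter_sample[OF that, of 1, OF _ Q_power_word_span] T[of m 1] T[of l 2] that
    by (simp add: open_block_one[unfolded One_nat_def] numeral_2_eq_2)
  have "\<phi> (Q ^ k) = (\<Sum>l=1..n. K 1 * T 1 + T 2) -
      1 / of_nat n * (\<Sum>l=1..n. \<Sum>m=1..n. K 1 * T 1 + (if m = l then T 2 else 0))"
    unfolding k power_Suc state_Q_mult using pair by simp
  also have "\<dots> = of_nat n * jump * T 2"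
    using n_pos by (simp add: sum.distrib jump_def field_simps)
  also have "\<dots> = (\<Sum>t\<le>k'. of_nat n * jump ^ (t + 1) * K (2 * (t + 1)) * \<phi> (Q ^ (k' - t)))"
    by (simp add: T_def sum_distrib_left mult_ac)
  also have "\<dots> = (\<Sum>m<k. of_nat n * jump ^ (k - m) * K (2 * (k - m)) * \<phi> (Q ^ m))"
    by (rule sum.reindex_bij_witness[of _ "\<lambda>m. k' - m" "\<lambda>t. k' - t"])
       (auto simp: k Suc_diff_le)
  finally show ?thesis .
qed

end

theorem proposition4p10:
  fixes smul :: "complex \<Rightarrow> 'a::ring_1 \<Rightarrow> 'a"
    and star :: "'a \<Rightarrow> 'a"
    and \<phi> :: "'a \<Rightarrow> complex"
    and X :: 'a
    and Xs :: "nat \<Rightarrow> 'a"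
    and n :: nat
  assumes "nc_prob_space smul star \<phi>"
    and "n \<ge> 2"
    and "X \<in> self_adjoint star"
    and "\<And>i. i \<in> {1..n} \<Longrightarrow> Xs i \<in> self_adjoint star"
    and "boolean_indep smul \<phi> {1..n} Xs"
    and "\<And>i. i \<in> {1..n} \<Longrightarrow> identically_distributed \<phi> (Xs i) X"
    and "cumulant_of \<phi> 2 X = 1"
  shows "has_law \<phi> (\<Sum>i=1..n. (Xs i - sample_mean smul n Xs) ^ 2)
           (measure_pmf (boolean_poisson (real n) (1 - 1 / real n)))
         \<longleftrightarrow> even_poisson \<phi> X"
proof -
  interpret nc_prob_space smul star \<phi> by (rule assms(1))
  interpret boolean_sample smul star \<phi> n Xs "\<lambda>r. cumulant_of \<phi> r X"
    by unfold_locales (use assms(2,5,6) in \<open>auto simp: identically_distributed_def\<close>)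
  let ?a = "1 - 1 / real n"
  let ?u = "\<lambda>k. complex_of_real
    (measure_pmf.expectation (boolean_poisson (real n) ?a) (\<lambda>x. x ^ k))"
  have jump: "jump = complex_of_real ?a" by (simp add: jump_def)
  have cancel: "of_nat n * jump ^ k * c = of_nat n * jump ^ k \<longleftrightarrow> c = 1" for k c
    using assms(2) by (simp add: jump_def)
  have u: "?u k = (\<Sum>m<k. (of_nat n * jump ^ (k - m)) * ?u m)" if "k > 0" for k
    using boolean_poisson_moment_recursion[of "real n" k ?a] that by (simp add: jump)
  have "has_law \<phi> Q (measure_pmf (boolean_poisson (real n) ?a)) \<longleftrightarrow> (\<forall>k. \<phi> (Q ^ k) = ?u k)"
    by (simp add: has_law_def integrable_boolean_poisson)
  also have "\<dots> \<longleftrightarrow> (\<forall>k>0. of_nat n * jump ^ k * cumulant_of \<phi> (2 * k) X = of_nat n * jump ^ k)"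
    by (rule recursion_determines_coefficients)
       (use Q_moment_recursion u in \<open>simp_all add: state_unit\<close>)
  also have "\<dots> \<longleftrightarrow> even_poisson \<phi> X"
    unfolding cancel even_poisson_def by (simp add: Suc_le_eq)
  finally show ?thesis unfolding Q_def .
qed

end
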